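(* Let $(X,V,W,S,\mathcal H_*,h,*,\Theta)$ satisfy the abstract symmetrization framework described in the context. Let $(X,\|\cdot\|_V)$ be a Banach space, and let $B,C$ be nonempty closed subsets of $S$ with $B\subset X_{\mathcal H_*}$ convex and $d(B,C)>0$. Moreover, let $x\in C$ be such that $S':=\mathrm{Drop}(x,B)\cap C$ is closed, $h(S'\times\mathcal H_* )\subset S'$ and $*(S')\subset S'$. Then, for all $\varepsilon>0$ small, there exists $\xi_\varepsilon\in\mathrm{Drop}(x,B)\cap C$ such that $$\mathrm{Drop}(\xi_\varepsilon,B)\cap C=\{\xi_\varepsilon\}\qquad\text{and}\qquad \|\xi_\varepsilon-\xi_\varepsilon^*\|_V<\varepsilon .$$
   Context: Abstract framework. $X,V,W$ are real Banach spaces with $X\subseteq V\subseteq W$, $X$ continuously embedded in $V$ and $V$ continuously embedded in $W$; $\|\cdot\|$ is the norm of $X$ and $\|\cdot\|_V$ the norm of $V$. $S\subseteq X$ carries the metric induced by $\|\cdot\|$, $\mathcal H_*$ is a path-connected topological space, and there are maps $*:S\to S$, $u\mapsto u^*$ (symmetrization) and $h:S\times\mathcal H_*\to S$, $(u,H)\mapsto u^H$ (polarization) such that: $h$ is continuous; $(u^* )^H=(u^H)^*=u^*$ and $(u^H)^H=u^H$ for all $u\in S$, $H\in\mathcal H_*$; there is a sequence $(H_m)\subset\mathcal H_*$ such that for every $u\in S$ the iterated polarizations $u^{H_1\cdots H_m}$ converge to $u^*$ in $V$ as $m\to\infty$; $\|u^H-v^H\|_V\le\|u-v\|_V$ for all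 $u,v\in S$, $H\in\mathcal H_*$. Moreover $\Theta:(X,\|\cdot\|_V)\to(S,\|\cdot\|_V)$ is Lipschitz with constant $C_\Theta>0$ and $\Theta|_S=\mathrm{Id}|_S$; for $u\in X$ one sets $u^H:=(\Theta(u))^H$ and $u^*:=(\Theta(u))^*$. $X_{\mathcal H_*}:=\{u\in S: u^H=u\text{ for all }H\in\mathcal H_*\}$. For $B\subset X$ convex and $x\in X$, $\mathrm{Drop}(x,B):=\{x+t(y-x): y\in B,\ t\in[0,1]\}$. $d(B,C)=\inf\{\|b-c\|_V: b\in B,\ c\in C\}$. "For all $\varepsilon>0$ small" means: there is $\varepsilon_0>0$ such that the assertion holds for all $\varepsilon\in(0,\varepsilon_0]$.
   Formalization: The set B is additionally assumed bounded; without this the claim fails, e.g. in the plane with trivial symmetrization, B={y≤0}, C={(s,1+e^{-s}): s≥0}, x=(0,2), where no drop from a point of C meets C only in its vertex. *)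

theory Defs
  imports "HOL-Analysis.Analysis"
begin

text \<open>
  \<open>iter_pol h Hm u m\<close> is \<open>u\<close> polarized successively by \<open>H\<^sub>1, \<dots>, H\<^sub>m\<close>, where \<open>H\<^sub>1\<close> is
  applied first. The sequence is indexed from 0, so \<open>Hm 0\<close> plays the role of \<open>H\<^sub>1\<close>.
\<close>

primrec iter_pol :: "('x \<times> 'h \<Rightarrow> 'x) \<Rightarrow> (nat \<Rightarrow> 'h) \<Rightarrow> 'x \<Rightarrow> nat \<Rightarrow> 'x" where
  "iter_pol h Hm u 0 = u"
| "iter_pol h Hm u (Suc m) = h (iter_pol h Hm u m, Hm m)"

text \<open>
  The continuous inclusions \<open>X \<subseteq> V \<subseteq> W\<close> of Banach spaces are rendered as injective bounded
  linear maps \<open>\<iota>\<close> and \<open>\<kappa>\<close> between three Banach-space types; thus the norm \<open>\<parallel>u\<parallel>\<^sub>V\<close> of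
  \<open>u \<in> X\<close> is \<open>norm (\<iota> u)\<close>, whereas \<open>norm u\<close> is the norm of \<open>X\<close>. The parameter space is
  a path-connected subspace \<open>Hs\<close> of a topological space. The map \<open>h (u, H)\<close> is the
  polarization \<open>u\<^sup>H\<close> and \<open>star u\<close> the symmetrization of \<open>u \<in> S\<close>. Values of \<open>h\<close> and \<open>star\<close>
  outside \<open>S \<times> Hs\<close> and \<open>S\<close> are irrelevant: for a general \<open>u \<in> X\<close> the polarization is
  \<open>h (\<Theta> u, H)\<close> and the symmetrization \<open>star (\<Theta> u)\<close>, which agrees with \<open>h (u, H)\<close> and
  \<open>star u\<close> on \<open>S\<close>.
\<close>

locale symmetrization_framework =
  fixes \<iota> :: "'x::banach \<Rightarrow> 'v::banach"
    and \<kappa> :: "'v \<Rightarrow> 'w::banach"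
    and S :: "'x set"
    and Hs :: "'h::topological_space set"
    and h :: "'x \<times> 'h \<Rightarrow> 'x"
    and star :: "'x \<Rightarrow> 'x"
    and \<Theta> :: "'x \<Rightarrow> 'x"
    and C\<^sub>\<Theta> :: real
  assumes embedding_X_V: "bounded_linear \<iota>" "inj \<iota>"
    and embedding_V_W: "bounded_linear \<kappa>" "inj \<kappa>"
    and path_connected_Hs: "path_connected Hs"
    and star_in_S: "\<And>u. u \<in> S \<Longrightarrow> star u \<in> S"
    and pol_in_S: "\<And>u H. u \<in> S \<Longrightarrow> H \<in> Hs \<Longrightarrow> h (u, H) \<in> S"
    and continuous_pol: "continuous_on (S \<times> Hs) h"
    and pol_star: "\<And>u H. u \<in> S \<Longrightarrow> H \<in> Hs \<Longrightarrow> h (star u, H) = star u"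
    and star_pol: "\<And>u H. u \<in> S \<Longrightarrow> H \<in> Hs \<Longrightarrow> star (h (u, H)) = star u"
    and pol_pol: "\<And>u H. u \<in> S \<Longrightarrow> H \<in> Hs \<Longrightarrow> h (h (u, H), H) = h (u, H)"
    and iter_pol_tendsto_star:
      "\<exists>Hm :: nat \<Rightarrow> 'h. range Hm \<subseteq> Hs \<and>
         (\<forall>u\<in>S. (\<lambda>m. \<iota> (iter_pol h Hm u m)) \<longlonglongrightarrow> \<iota> (star u))"
    and pol_contraction:
      "\<And>u v H. u \<in> S \<Longrightarrow> v \<in> S \<Longrightarrow> H \<in> Hs \<Longrightarrow>
         norm (\<iota> (h (u, H) - h (v, H))) \<le> norm (\<iota> (u - v))"
    and Theta_in_S: "\<And>u. \<Theta> u \<in> S"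
    and C_Theta_pos: "C\<^sub>\<Theta> > 0"
    and Theta_lipschitz: "\<And>u v. norm (\<iota> (\<Theta> u - \<Theta> v)) \<le> C\<^sub>\<Theta> * norm (\<iota> (u - v))"
    and Theta_id: "\<And>u. u \<in> S \<Longrightarrow> \<Theta> u = u"

definition pol_invariant :: "'x set \<Rightarrow> 'h set \<Rightarrow> ('x \<times> 'h \<Rightarrow> 'x) \<Rightarrow> 'x set" where
  "pol_invariant S Hs h = {u \<in> S. \<forall>H\<in>Hs. h (u, H) = u}"

definition Drop :: "'x::real_vector \<Rightarrow> 'x set \<Rightarrow> 'x set" where
  "Drop x B = {x + t *\<^sub>R (y - x) | y t. y \<in> B \<and> t \<in> {0..1}}"

end

theory Submission
  imports Defs
begin

text \<open>
  Since \<open>\<Theta>\<close> is a retraction that is continuous for the \<open>V\<close>-norm, \<open>S\<close>, and hence \<open>B\<close> and \<open>C\<close>,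
  are closed in \<open>X\<close>. Let \<open>g\<close> be the \<open>V\<close>-distance to \<open>B\<close>. Polarizations fix \<open>B\<close> and contract the
  \<open>V\<close>-norm, so \<open>g (star u) \<le> g u\<close>, and \<open>g\<close> is almost minimized on \<open>Drop x B \<inter> C\<close> by some
  symmetric \<open>v\<close>. The drop theorem, applied from \<open>v\<close>, gives \<open>\<xi> = v + t (y - v)\<close> with the required
  drop property. As \<open>g \<xi> \<le> (1 - t) g v\<close> by convexity and \<open>g\<close> is bounded away from 0 on \<open>C\<close>,
  almost minimality of \<open>v\<close> forces \<open>t\<close> to be small, and then \<open>\<xi>\<close> is close to
  \<open>v\<close> and \<open>star \<xi>\<close> to \<open>star v = v\<close>.
\<close>

section \<open>Geometry and topology of drops\<close>

lemma mem_Drop_iff: "w \<in> Drop u B \<longleftrightarrow> (\<exists>y t. w = u + t *\<^sub>R (y - u) \<and> y \<in> B \<and> 0 \<le> t \<and> t \<le> 1)"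
  by (auto simp: Drop_def)

lemma self_in_Drop: "B \<noteq> {} \<Longrightarrow> u \<in> Drop u B"
  unfolding mem_Drop_iff by (metis all_not_in_conv add.right_neutral order_refl scale_zero_left zero_le_one)

text \<open>A segment to \<open>y'\<close> starting on a segment from \<open>u\<close> to
  \<open>y\<close> stays in the triangle spanned by \<open>u\<close>, \<open>y\<close>,
  \<open>y'\<close>; convexity keeps the edge from \<open>y\<close> to \<open>y'\<close> inside
  \<open>B\<close>.\<close>

lemma Drop_mono:
  assumes "convex B" "w \<in> Drop u B"
  shows "Drop w B \<subseteq> Drop u B"
proof
  fix z assume "z \<in> Drop w B"
  then obtain y' s where z: "z = w + s *\<^sub>R (y' - w)" "y' \<in> B" "0 \<le> s" "s \<le> 1"
    by (auto simp: mem_Drop_iff)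
  obtain y t where w: "w = u + t *\<^sub>R (y - u)" "y \<in> B" "0 \<le> t" "t \<le> 1"
    using assms(2) by (auto simp: mem_Drop_iff)
  \<comment> \<open>\<open>r\<close> is the total weight that \<open>z\<close> puts on
    \<open>y\<close> and \<open>y'\<close>, and \<open>1 - r\<close> the weight left on
    \<open>u\<close>. Normalizing by \<open>r\<close> gives the point \<open>b\<close>, hence the
    separate case \<open>r = 0\<close>, where \<open>z = w\<close>.\<close>
  define r where "r = t + s - s * t"
  have r: "r = t * (1 - s) + s" "1 - r = (1 - s) * (1 - t)"
    by (auto simp: r_def algebra_simps)
  have r0: "0 \<le> r" using r(1) z w by simp
  have r1: "r \<le> 1"
    using r(2) z w by (metis diff_ge_0_iff_ge mult_nonneg_nonneg)
  show "z \<in> Drop u B"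
  proof (cases "r = 0")
    case True
    have "t * (1 - s) \<ge> 0" using z w by simp
    then have "s = 0" using r(1) z(3) True by linarith
    then show ?thesis using assms(2) z(1) by simp
  next
    case False
    define b where "b = (t * (1 - s) / r) *\<^sub>R y + (s / r) *\<^sub>R y'"
    have "t * (1 - s) / r + s / r = 1"
      using False r(1) by (metis add_divide_distrib divide_self)
    then have "b \<in> B"
      unfolding b_def using z w r0 by (intro convexD[OF assms(1)]) auto
    moreover have "z = u + r *\<^sub>R (b - u)"
    proof -
      have rb: "r *\<^sub>R b = (t * (1 - s)) *\<^sub>R y + s *\<^sub>R y'"
        using False by (simp add: b_def scaleR_add_right)
      have "z = (1 - r) *\<^sub>R u + r *\<^sub>R b"
        unfolding rb r(2) z(1) w(1) by (simp add: algebra_simps)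
      then show ?thesis by (simp add: algebra_simps)
    qed
    ultimately show ?thesis using r0 r1 by (auto simp: mem_Drop_iff)
  qed
qed

text \<open>\<open>B\<close> need not be compact, so only the scalars \<open>t\<close> are passed to
  a convergent subsequence. A nonzero limit lets the points of \<open>B\<close> be solved for; a
  zero limit makes the drop points collapse to \<open>u\<close> because \<open>B\<close> is
  bounded.\<close>

lemma closed_Drop:
  fixes B :: "'a::real_normed_vector set"
  assumes "closed B" "bounded B" "B \<noteq> {}"
  shows "closed (Drop u B)"
  unfolding closed_sequential_limits
proof (intro allI impI, elim conjE)
  fix w l assume w: "\<forall>n. w n \<in> Drop u B" and lim: "w \<longlonglongrightarrow> l"
  have "\<forall>n. \<exists>y t. w n = u + t *\<^sub>R (y - u) \<and> y \<in> B \<and> 0 \<le> t \<and> t \<le> 1"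
    using w by (simp add: mem_Drop_iff)
  then obtain y t where eq: "\<And>n. w n = u + t n *\<^sub>R (y n - u)" and yB: "\<And>n. y n \<in> B"
      and t01: "\<And>n. 0 \<le> t n" "\<And>n. t n \<le> 1"
    by metis
  have "compact {0..1::real}" "\<forall>n. t n \<in> {0..1}"
    using t01 by auto
  then obtain s r where s: "s \<in> {0..1}" and r: "strict_mono r" and ts: "(t \<circ> r) \<longlonglongrightarrow> s"
    unfolding compact_def by metis
  have ts: "(\<lambda>n. t (r n)) \<longlonglongrightarrow> s"
    using ts by (simp add: comp_def)
  have lim': "(\<lambda>n. w (r n)) \<longlonglongrightarrow> l"
    using LIMSEQ_subseq_LIMSEQ[OF lim r] by (simp add: comp_def)
  show "l \<in> Drop u B"
  proof (cases "s = 0")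
    case True
    obtain M where M: "\<And>b. b \<in> B \<Longrightarrow> dist u b \<le> M"
      using assms(2) by (metis bounded_any_center)
    have lim0: "(\<lambda>n. t (r n) * M) \<longlonglongrightarrow> 0"
      using tendsto_mult_left_zero[OF ts[unfolded True]] .
    have "norm (w (r n) - u) \<le> t (r n) * M" for n
      using M[OF yB[of "r n"]] t01(1)[of "r n"]
      by (simp add: eq dist_norm norm_minus_commute mult_left_mono)
    then have "(\<lambda>n. w (r n) - u) \<longlonglongrightarrow> 0"
      by (intro Lim_null_comparison[OF always_eventually lim0]) blast
    then have "(\<lambda>n. w (r n)) \<longlonglongrightarrow> u"
      by (simp add: LIM_zero_iff)
    then have "l = u" using lim' LIMSEQ_unique by blast
    then show ?thesis using self_in_Drop assms(3) by blast
  next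
    case False
    define b where "b = u + (1 / s) *\<^sub>R (l - u)"
    have ev: "\<forall>\<^sub>F n in sequentially. t (r n) \<noteq> 0"
      using tendsto_imp_eventually_ne[OF ts False] .
    have "(\<lambda>n. u + (1 / t (r n)) *\<^sub>R (w (r n) - u)) \<longlonglongrightarrow> b"
      unfolding b_def using ts lim' False by (intro tendsto_intros)
    then have "(\<lambda>n. y (r n)) \<longlonglongrightarrow> b"
      by (rule Lim_transform_eventually) (use ev in eventually_elim, simp add: eq)
    then have "b \<in> B"
      using assms(1) yB by (metis closed_sequentially)
    moreover have "l = u + s *\<^sub>R (b - u)"
      using False by (simp add: b_def)
    ultimately show ?thesis using s by (auto simp: mem_Drop_iff)
  qed
qed

section \<open>Distance to a convex set and the drop theorem\<close>

lemma le_infdist: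
  assumes "B \<noteq> {}" "\<And>b. b \<in> B \<Longrightarrow> e \<le> dist u b"
  shows "e \<le> infdist u B"
  using assms by (auto simp: infdist_notempty intro!: cINF_greatest)

lemma setdist_le_infdist: "B \<noteq> {} \<Longrightarrow> u \<in> C \<Longrightarrow> setdist B C \<le> infdist u B"
  by (rule le_infdist) (auto simp: dist_commute intro: order_trans[OF setdist_le_dist])

text \<open>For \<open>b\<close> in \<open>B\<close>, the competitor \<open>(1 - t) b + t y\<close>
  lies in \<open>B\<close>, and its difference from the moved point is \<open>u - b\<close> scaled
  by \<open>1 - t\<close>.\<close>

lemma infdist_Drop_le:
  fixes B :: "'a::real_normed_vector set"
  assumes "convex B" "y \<in> B" "0 \<le> t" "t \<le> 1"
  shows "infdist (u + t *\<^sub>R (y - u)) B \<le> (1 - t) * infdist u B"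
proof (cases "t = 1")
  case True
  then show ?thesis using assms(2) by simp
next
  case False
  then have t: "0 < 1 - t" using assms(4) by simp
  have "infdist (u + t *\<^sub>R (y - u)) B / (1 - t) \<le> infdist u B"
  proof (rule le_infdist)
    fix b assume b: "b \<in> B"
    have "infdist (u + t *\<^sub>R (y - u)) B \<le> dist (u + t *\<^sub>R (y - u)) ((1 - t) *\<^sub>R b + t *\<^sub>R y)"
      using assms b by (intro infdist_le convexD) auto
    also have "(u + t *\<^sub>R (y - u)) - ((1 - t) *\<^sub>R b + t *\<^sub>R y) = (1 - t) *\<^sub>R (u - b)"
      by (simp add: algebra_simps)
    then have "dist (u + t *\<^sub>R (y - u)) ((1 - t) *\<^sub>R b + t *\<^sub>R y) = (1 - t) * dist u b"
      using t by (simp add: dist_norm)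
    finally show "infdist (u + t *\<^sub>R (y - u)) B / (1 - t) \<le> dist u b"
      using t by (simp add: pos_divide_le_eq mult.commute)
  qed (use assms(2) in blast)
  then show ?thesis using t by (simp add: pos_divide_le_eq mult.commute)
qed

text \<open>Danes' drop theorem. Nested drops are chosen greedily, each from a near minimizer of the
  distance to \<open>B\<close> in the previous one; their diameters tend to 0, and completeness
  yields a single common point.\<close>

theorem drop_theorem:
  fixes B C :: "'a::banach set"
  assumes "closed B" "bounded B" "B \<noteq> {}" "convex B" "closed C"
    and pos: "setdist B C > 0" and "v \<in> C"
  shows "\<exists>\<xi> \<in> Drop v B \<inter> C. Drop \<xi> B \<inter> C = {\<xi>}"
proof -
  define D where "D u = Drop u B \<inter> C" for u
  define f where "f u = infdist u B" for u
  define d where "d = setdist B C"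
  have f_ge: "d \<le> f u" if "u \<in> C" for u
    unfolding f_def d_def using setdist_le_infdist[OF assms(3) that] .
  have bdd: "bdd_below (f ` A)" for A
    by (rule bdd_belowI[of _ 0]) (auto simp: f_def infdist_nonneg)
  have self: "u \<in> D u" if "u \<in> C" for u
    using that self_in_Drop[OF assms(3)] by (auto simp: D_def)
  have mono: "D w \<subseteq> D u" if "w \<in> D u" for u w
    using that Drop_mono[OF assms(4)] by (auto simp: D_def)
  obtain M where M: "M > 0" "\<And>b. b \<in> B \<Longrightarrow> dist v b \<le> M"
    using assms(2) by (metis bounded_any_center dual_order.trans linorder_le_cases not_one_le_zero
        linorder_not_le)
  have near: "dist v w \<le> M" if w: "w \<in> D v" for w
  proof -
    obtain y t where w: "w = v + t *\<^sub>R (y - v)" "y \<in> B" "0 \<le> t" "t \<le> 1"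
      using w by (auto simp: D_def mem_Drop_iff)
    have "dist v w = t * dist v y" using w by (simp add: dist_norm norm_minus_commute)
    also have "\<dots> \<le> 1 * M" using w M by (intro mult_mono) auto
    finally show ?thesis by simp
  qed
  have "\<exists>w. w \<in> D u \<and> f w < Inf (f ` D u) + (1/2) ^ n" if "u \<in> C" for u and n :: nat
  proof -
    have "Inf (f ` D u) < Inf (f ` D u) + (1/2) ^ n" by simp
    then show ?thesis
      using cInf_lessD[of "f ` D u"] self[OF that] by blast
  qed
  then have ex: "\<exists>w. w \<in> D v \<and> w \<in> D u \<and> f w < Inf (f ` D u) + (1/2) ^ n"
    if "u \<in> D v" for u and n :: nat
    using that mono D_def by blast
  obtain U where U: "\<And>n. U n \<in> D v" "\<And>n. U (Suc n) \<in> D (U n)"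
      "\<And>n. f (U (Suc n)) < Inf (f ` D (U n)) + (1/2) ^ n"
    using dependent_nat_choice[of "\<lambda>_ u. u \<in> D v"
        "\<lambda>n u w. w \<in> D u \<and> f w < Inf (f ` D u) + (1/2) ^ n"] ex self[OF assms(7)] by metis
  \<comment> \<open>Bound for the step size \<open>t\<close> below, times a bound for the distance
    from \<open>U (Suc n)\<close> to points of \<open>B\<close>.\<close>
  define \<rho> where "\<rho> n = (1/2) ^ n / d * (2 * M)" for n :: nat
  have small: "dist (U (Suc n)) w \<le> \<rho> n" if w: "w \<in> D (U (Suc n))" for n w
  proof -
    obtain y t where yt: "w = U (Suc n) + t *\<^sub>R (y - U (Suc n))" "y \<in> B" "0 \<le> t" "t \<le> 1"
      using w by (auto simp: D_def mem_Drop_iff)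
    \<comment> \<open>\<open>w\<close> still competes in the earlier drop, whose infimum
      \<open>U (Suc n)\<close> misses by less than \<open>(1/2) ^ n\<close>. Moving by
      \<open>t\<close> towards \<open>B\<close> lowers \<open>f\<close> by at least
      \<open>t * d\<close>, so \<open>t\<close> must be small.\<close>
    have "Inf (f ` D (U n)) \<le> f w"
      using w mono[OF U(2)] bdd by (intro cINF_lower) auto
    also have "f w \<le> (1 - t) * f (U (Suc n))"
      unfolding f_def yt(1) using assms(4) yt by (intro infdist_Drop_le)
    finally have "t * f (U (Suc n)) < (1/2) ^ n"
      using U(3)[of n] by (simp add: algebra_simps)
    moreover have "t * d \<le> t * f (U (Suc n))"
      using yt f_ge U(1) by (intro mult_left_mono) (auto simp: D_def)
    ultimately have t: "t \<le> (1/2) ^ n / d"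
      using pos by (simp add: d_def pos_le_divide_eq)
    have "dist (U (Suc n)) y \<le> 2 * M"
      using near[OF U(1)] M(2)[OF yt(2)] by (metis add_mono dist_commute dist_triangle2 mult_2 order_trans)
    then have "t * dist (U (Suc n)) y \<le> \<rho> n"
      unfolding \<rho>_def using t yt by (intro mult_mono) (auto simp: d_def setdist_pos_le)
    moreover have "dist (U (Suc n)) w = t * dist (U (Suc n)) y"
      using yt by (simp add: dist_norm norm_minus_commute)
    ultimately show ?thesis by simp
  qed
  have lim0: "\<rho> \<longlonglongrightarrow> 0"
    unfolding \<rho>_def by (intro tendsto_mult_left_zero tendsto_divide_zero LIMSEQ_power_zero) simp
  have decseq: "D (U n) \<subseteq> D (U m)" if "m \<le> n" for m n
    using that by (rule lift_Suc_antimono_le[of "\<lambda>n. D (U n)", rotated]) (use mono U(2) in blast)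
  have "\<exists>\<xi>. \<Inter>(range (\<lambda>n. D (U n))) = {\<xi>}"
  proof (rule decreasing_closed_nest_sing)
    show "closed (D (U n))" for n
      unfolding D_def by (intro closed_Int closed_Drop assms)
    show "D (U n) \<noteq> {}" for n using U(2) by blast
    show "D (U n) \<subseteq> D (U m)" if "m \<le> n" for m n using decseq that .
    fix e :: real assume "e > 0"
    then have "\<forall>\<^sub>F n in sequentially. \<rho> n < e / 2"
      by (intro order_tendstoD(2)[OF lim0]) simp
    then obtain n where n: "\<rho> n < e / 2"
      unfolding eventually_sequentially by blast
    have "dist a b < e" if "a \<in> D (U (Suc n))" "b \<in> D (U (Suc n))" for a b
      using small[OF that(1)] small[OF that(2)] dist_triangle3[of a b "U (Suc n)"] n by linarith
    then show "\<exists>n. \<forall>a\<in>D (U n). \<forall>b\<in>D (U n). dist a b < e" by blast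
  qed
  then obtain \<xi> where \<xi>: "(\<Inter>n. D (U n)) = {\<xi>}" by blast
  \<comment> \<open>\<open>\<xi>\<close> lies in every \<open>D (U n)\<close>, so
    \<open>D \<xi>\<close> does too, and hence lies in their intersection.\<close>
  then have "D \<xi> \<subseteq> {\<xi>}" using mono by blast
  moreover have "\<xi> \<in> D v" using \<xi> mono[OF U(1)] by blast
  ultimately show ?thesis using self unfolding D_def by blast
qed

section \<open>Consequences of the symmetrization axioms\<close>

context symmetrization_framework
begin

sublocale bounded_linear \<iota>
  by (rule embedding_X_V)

text \<open>Convergence in X implies convergence in V, where \<open>\<Theta>\<close> is continuous
  and fixes the sequence; injectivity of \<open>\<iota>\<close> then gives
  \<open>l = \<Theta> l\<close>. This turns relative closedness in \<open>S\<close> into closedness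
  in X.\<close>

lemma closed_S: "closed S"
  unfolding closed_sequential_limits
proof (intro allI impI, elim conjE)
  fix u l assume u: "\<forall>n. u n \<in> S" and lim: "u \<longlonglongrightarrow> l"
  have lim0: "(\<lambda>n. C\<^sub>\<Theta> * norm (\<iota> (u n - l))) \<longlonglongrightarrow> 0"
    using tendsto[OF LIM_zero[OF lim]] by (intro tendsto_mult_right_zero tendsto_norm_zero) (simp add: zero)
  have "(\<lambda>n. \<iota> (u n) - \<iota> (\<Theta> l)) \<longlonglongrightarrow> 0"
  proof (rule Lim_null_comparison[OF _ lim0], intro always_eventually allI)
    show "norm (\<iota> (u n) - \<iota> (\<Theta> l)) \<le> C\<^sub>\<Theta> * norm (\<iota> (u n - l))" for n
      using Theta_lipschitz[of "u n" l] Theta_id u by (simp add: diff)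
  qed
  then have "(\<lambda>n. \<iota> (u n)) \<longlonglongrightarrow> \<iota> (\<Theta> l)" by (simp add: LIM_zero_iff)
  then have "\<iota> l = \<iota> (\<Theta> l)" using tendsto[OF lim] LIMSEQ_unique by blast
  then have "l = \<Theta> l" using embedding_X_V(2) by (simp add: inj_eq)
  then show "l \<in> S" by (metis Theta_in_S)
qed

lemma iter_pol_in_S:
  assumes "range Hm \<subseteq> Hs" "u \<in> S"
  shows "iter_pol h Hm u m \<in> S"
  using assms by (induction m) (auto intro: pol_in_S)

text \<open>Polarizations fix \<open>star u\<close>, so its iterated polarizations are
  constant.\<close>

lemma star_star:
  assumes "u \<in> S"
  shows "star (star u) = star u"
proof -
  obtain Hm where Hm: "range Hm \<subseteq> Hs"
      "\<And>u. u \<in> S \<Longrightarrow> (\<lambda>m. \<iota> (iter_pol h Hm u m)) \<longlonglongrightarrow> \<iota> (star u)"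
    using iter_pol_tendsto_star by blast
  have "iter_pol h Hm (star u) m = star u" for m
    using Hm(1) assms by (induction m) (auto intro: pol_star)
  then have "(\<lambda>m. \<iota> (star u)) \<longlonglongrightarrow> \<iota> (star (star u))"
    using Hm(2)[OF star_in_S[OF assms]] by simp
  then show ?thesis
    using embedding_X_V(2) by (simp add: LIMSEQ_const_iff inj_eq)
qed

text \<open>The contraction property of polarizations passes to the limit, since one sequence
  \<open>Hm\<close> serves all points of \<open>S\<close>.\<close>

lemma star_contraction:
  assumes "u \<in> S" "v \<in> S"
  shows "norm (\<iota> (star u - star v)) \<le> norm (\<iota> (u - v))"
proof -
  obtain Hm where Hm: "range Hm \<subseteq> Hs"
      "\<And>u. u \<in> S \<Longrightarrow> (\<lambda>m. \<iota> (iter_pol h Hm u m)) \<longlonglongrightarrow> \<iota> (star u)"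
    using iter_pol_tendsto_star by blast
  have "norm (\<iota> (iter_pol h Hm u m - iter_pol h Hm v m)) \<le> norm (\<iota> (u - v))" for m
  proof (induction m)
    case (Suc m)
    then show ?case
      using pol_contraction[OF iter_pol_in_S iter_pol_in_S, of Hm u Hm v "Hm m" m m] Hm(1) assms
      by fastforce
  qed simp
  then have "\<And>m. norm (\<iota> (iter_pol h Hm u m) - \<iota> (iter_pol h Hm v m)) \<le> norm (\<iota> (u - v))"
    by (simp add: diff)
  moreover have "(\<lambda>m. norm (\<iota> (iter_pol h Hm u m) - \<iota> (iter_pol h Hm v m)))
      \<longlonglongrightarrow> norm (\<iota> (star u) - \<iota> (star v))"
    using Hm(2) assms by (intro tendsto_intros)
  ultimately show ?thesis
    by (simp add: diff) (intro LIMSEQ_le_const2, auto)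
qed

lemma star_invariant:
  assumes "b \<in> pol_invariant S Hs h"
  shows "star b = b"
proof -
  have b: "b \<in> S" "\<And>H. H \<in> Hs \<Longrightarrow> h (b, H) = b"
    using assms by (auto simp: pol_invariant_def)
  obtain Hm where Hm: "range Hm \<subseteq> Hs" "(\<lambda>m. \<iota> (iter_pol h Hm b m)) \<longlonglongrightarrow> \<iota> (star b)"
    using iter_pol_tendsto_star b(1) by blast
  have "iter_pol h Hm b m = b" for m
    using Hm(1) b(2) by (induction m) auto
  then show ?thesis
    using Hm(2) embedding_X_V(2) by (simp add: LIMSEQ_const_iff inj_eq)
qed

text \<open>\<open>star\<close> fixes \<open>B\<close> pointwise and does not increase
  V-distances.\<close>

lemma infdist_star_le:
  assumes "u \<in> S" "B \<subseteq> pol_invariant S Hs h" "B \<noteq> {}"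
  shows "infdist (\<iota> (star u)) (\<iota> ` B) \<le> infdist (\<iota> u) (\<iota> ` B)"
proof (rule le_infdist)
  fix c assume "c \<in> \<iota> ` B"
  then obtain b where b: "b \<in> B" "c = \<iota> b" by blast
  then have "infdist (\<iota> (star u)) (\<iota> ` B) \<le> dist (\<iota> (star u)) (\<iota> (star b))"
    using star_invariant assms(2) by (intro infdist_le) auto
  also have "\<dots> \<le> dist (\<iota> u) c"
    using star_contraction[OF assms(1), of b] b assms(2)
    by (auto simp: dist_norm diff pol_invariant_def)
  finally show "infdist (\<iota> (star u)) (\<iota> ` B) \<le> dist (\<iota> u) c" .
qed (use assms(3) in simp)

end

section \<open>Nearly symmetric points with singleton drops\<close>

theorem theorem3p10:
  fixes \<iota> :: "'x::banach \<Rightarrow> 'v::banach"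
    and \<kappa> :: "'v \<Rightarrow> 'w::banach"
    and S :: "'x set"
    and Hs :: "'h::topological_space set"
    and h :: "'x \<times> 'h \<Rightarrow> 'x"
    and star :: "'x \<Rightarrow> 'x"
    and \<Theta> :: "'x \<Rightarrow> 'x"
    and C\<^sub>\<Theta> :: real
    and B C :: "'x set"
    and x :: 'x
  assumes framework: "symmetrization_framework \<iota> \<kappa> S Hs h star \<Theta> C\<^sub>\<Theta>"
    and banach_V: "complete (range \<iota>)"
    and B_nonempty: "B \<noteq> {}"
    and C_nonempty: "C \<noteq> {}"
    and B_closed: "closedin (top_of_set S) B"
    and C_closed: "closedin (top_of_set S) C"
    and B_invariant: "B \<subseteq> pol_invariant S Hs h"
    and B_convex: "convex B"
    and B_bounded: "bounded B"
    and dist_pos: "setdist (\<iota> ` B) (\<iota> ` C) > 0"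
    and x_in_C: "x \<in> C"
    and drop_closed: "closed (Drop x B \<inter> C)"
    and drop_pol: "h ` ((Drop x B \<inter> C) \<times> Hs) \<subseteq> Drop x B \<inter> C"
    and drop_star: "star ` (Drop x B \<inter> C) \<subseteq> Drop x B \<inter> C"
  shows "\<exists>\<epsilon>\<^sub>0>0. \<forall>\<epsilon>. 0 < \<epsilon> \<and> \<epsilon> \<le> \<epsilon>\<^sub>0 \<longrightarrow>
           (\<exists>\<xi> \<in> Drop x B \<inter> C. Drop \<xi> B \<inter> C = {\<xi>} \<and> norm (\<iota> (\<xi> - star \<xi>)) < \<epsilon>)"
proof -
  interpret symmetrization_framework \<iota> \<kappa> S Hs h star \<Theta> C\<^sub>\<Theta> by (rule framework)
  have closed: "closed B" "closed C" and CS: "C \<subseteq> S"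
    using B_closed C_closed closed_S closedin_closed_trans closedin_imp_subset by blast+
  define S' where "S' = Drop x B \<inter> C"
  define g where "g u = infdist (\<iota> u) (\<iota> ` B)" for u
  define d where "d = setdist (\<iota> ` B) (\<iota> ` C)"
  define m where "m = Inf (g ` S')"
  have d: "d > 0" using dist_pos by (simp add: d_def)
  have g_ge: "d \<le> g u" if "u \<in> C" for u
    unfolding d_def g_def using B_nonempty that by (intro setdist_le_infdist) auto
  have bdd: "bdd_below (g ` S')"
    by (rule bdd_belowI[of _ 0]) (auto simp: g_def infdist_nonneg)
  have S'_ne: "S' \<noteq> {}"
    using x_in_C self_in_Drop[OF B_nonempty] by (auto simp: S'_def)
  have "bounded (\<iota> ` B)"
    using bounded_linear_image[OF B_bounded embedding_X_V(1)] .
  then obtain M0 where M0: "\<And>b. b \<in> B \<Longrightarrow> dist (\<iota> x) (\<iota> b) \<le> M0"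
    by (metis bounded_any_center imageI)
  \<comment> \<open>The maximum with 1 makes \<open>M\<close> positive, as the choice of
    \<open>\<delta>\<close> divides by it.\<close>
  define M where "M = max M0 1"
  have M: "M > 0" "\<And>b. b \<in> B \<Longrightarrow> norm (\<iota> (b - x)) \<le> M"
    using M0 by (auto simp: M_def dist_norm diff norm_minus_commute le_max_iff_disj)
  have near: "norm (\<iota> (w - x)) \<le> M" if w: "w \<in> Drop x B" for w
  proof -
    obtain y t where w: "w = x + t *\<^sub>R (y - x)" "y \<in> B" "0 \<le> t" "t \<le> 1"
      using w by (auto simp: mem_Drop_iff)
    have "norm (\<iota> (w - x)) = t * norm (\<iota> (y - x))" using w by (simp add: scaleR)
    also have "\<dots> \<le> 1 * M" using w M by (intro mult_mono) auto
    finally show ?thesis by simp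
  qed
  \<comment> \<open>The drop theorem is applied in the norm of X, while the hypothesis separates the
    sets in V; boundedness of \<open>\<iota>\<close> transfers the gap.\<close>
  have dist_X: "setdist B C > 0"
  proof -
    obtain K where K: "K > 0" "\<And>z. norm (\<iota> z) \<le> norm z * K"
      using pos_bounded by blast
    have "d / K \<le> setdist B C"
    proof (rule le_setdistI)
      fix b c assume "b \<in> B" "c \<in> C"
      then have "d \<le> dist (\<iota> b) (\<iota> c)" unfolding d_def by (intro setdist_le_dist) auto
      also have "\<dots> \<le> dist b c * K" using K(2)[of "b - c"] by (simp add: dist_norm diff)
      finally show "d / K \<le> dist b c" using K(1) by (simp add: pos_divide_le_eq)
    qed (use B_nonempty C_nonempty in auto)
    moreover have "d / K > 0" using d K(1) by simp
    ultimately show ?thesis by linarith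
  qed
  have "\<exists>\<xi> \<in> Drop x B \<inter> C. Drop \<xi> B \<inter> C = {\<xi>} \<and> norm (\<iota> (\<xi> - star \<xi>)) < \<epsilon>" if "\<epsilon> > 0" for \<epsilon> :: real
  proof -
    \<comment> \<open>With \<open>t \<le> \<delta> / d\<close> and \<open>y\<close> within
      \<open>2 * M\<close> of \<open>v\<close> in V, \<open>\<xi>\<close> is within
      \<open>2 * \<epsilon> / 5\<close> of \<open>v\<close>, strictly below
      \<open>\<epsilon> / 2\<close>.\<close>
    define \<delta> where "\<delta> = \<epsilon> * d / (5 * M)"
    have \<delta>: "\<delta> > 0" using that d M by (simp add: \<delta>_def)
    have "Inf (g ` S') < m + \<delta>" using \<delta> by (simp add: m_def)
    then obtain u where u: "u \<in> S'" "g u < m + \<delta>"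
      using cInf_less_iff[of "g ` S'"] bdd S'_ne by (metis imageE image_is_empty)
    have uS: "u \<in> S" using u(1) CS by (auto simp: S'_def)
    \<comment> \<open>Symmetrizing \<open>u\<close> stays in \<open>S'\<close> and does not increase
      \<open>g\<close>, so \<open>v\<close> is a near minimizer fixed by
      \<open>star\<close>.\<close>
    define v where "v = star u"
    have v: "v \<in> S'" "star v = v" "v \<in> C" "v \<in> S"
      using drop_star u(1) uS CS star_star by (auto simp: S'_def v_def)
    have gv: "g v < m + \<delta>"
      using infdist_star_le[OF uS B_invariant B_nonempty] u(2) by (simp add: g_def v_def)
    obtain \<xi> where \<xi>: "\<xi> \<in> Drop v B \<inter> C" "Drop \<xi> B \<inter> C = {\<xi>}"
      using drop_theorem[OF closed(1) B_bounded B_nonempty B_convex closed(2) dist_X v(3)] by blast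
    have \<xi>S': "\<xi> \<in> S'"
      using \<xi>(1) v(1) Drop_mono[OF B_convex] by (auto simp: S'_def)
    obtain y t where yt: "\<xi> = v + t *\<^sub>R (y - v)" "y \<in> B" "0 \<le> t" "t \<le> 1"
      using \<xi>(1) by (auto simp: mem_Drop_iff)
    \<comment> \<open>Since \<open>\<xi>\<close> also competes for the infimum \<open>m\<close>, the
      decrease \<open>t * g v\<close> is at most \<open>\<delta>\<close>.\<close>
    have "m \<le> g \<xi>" unfolding m_def using \<xi>S' bdd by (intro cINF_lower)
    also have "g \<xi> = infdist (\<iota> v + t *\<^sub>R (\<iota> y - \<iota> v)) (\<iota> ` B)"
      by (simp add: g_def yt(1) add scaleR diff)
    also have "\<dots> \<le> (1 - t) * g v"
      unfolding g_def using yt B_convex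
      by (intro infdist_Drop_le convex_linear_image linear_axioms) auto
    finally have "t * g v \<le> \<delta>" using gv by (simp add: algebra_simps)
    moreover have "t * d \<le> t * g v" using yt g_ge v by (intro mult_left_mono) auto
    ultimately have t: "t \<le> \<delta> / d" using d by (simp add: pos_le_divide_eq)
    have "norm (\<iota> (y - v)) \<le> norm (\<iota> (y - x)) + norm (\<iota> (v - x))"
      by (simp add: diff) (metis dist_norm dist_triangle2)
    also have "\<dots> \<le> 2 * M" using M(2)[OF yt(2)] near[of v] v(1) by (simp add: S'_def)
    finally have "t * norm (\<iota> (y - v)) \<le> \<delta> / d * (2 * M)"
      using t yt \<delta> d by (intro mult_mono) auto
    also have "\<dots> < \<epsilon> / 2" using that d M(1) by (simp add: \<delta>_def field_simps)
    finally have close: "norm (\<iota> (\<xi> - v)) < \<epsilon> / 2" using yt by (simp add: scaleR)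
    have "norm (\<iota> (\<xi> - star \<xi>)) \<le> norm (\<iota> (\<xi> - v)) + norm (\<iota> (star \<xi> - star v))"
      unfolding v(2) by (simp add: diff) (metis dist_norm dist_triangle2)
    also have "norm (\<iota> (star \<xi> - star v)) \<le> norm (\<iota> (\<xi> - v))"
      using \<xi>(1) v CS by (intro star_contraction) auto
    finally have "norm (\<iota> (\<xi> - star \<xi>)) < \<epsilon>" using close by linarith
    then show ?thesis using \<xi>(2) \<xi>S' by (auto simp: S'_def)
  qed
  \<comment> \<open>Every positive \<open>\<epsilon>\<close> has been handled, so the threshold 1 is
    arbitrary.\<close>
  then show ?thesis by (intro exI[of _ 1]) auto
qed

end
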